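(* Let $\gamma\in(0,1)$, let $\omega=(\omega_1,\dots,\omega_N)\in[\gamma,1]^N$, and let $s$ be a positive integer. If $A\in\mathbb{C}^{m\times N}$ satisfies RIP of order $2s$ with $\delta_{2s}<\frac{\gamma}{\gamma+2}$, then for every $x\in\mathbb{C}^N$ and $y=Ax+e\in\mathbb{C}^m$ with $\|e\|_2\le\rho$, the solution $\hat{x}$ of $$\min_{z\in\mathbb{C}^N}\|z\|_{\omega,1}\quad\text{subject to}\quad\|Az-y\|_2\le\rho$$ satisfies $$\|x-\hat{x}\|_{\omega,1}\le A_1\sigma_s(x)_{\omega,1}+B_1\sqrt{s}\,\rho,\qquad \|x-\hat{x}\|_2\le A_2\frac{\sigma_s(x)_{\omega,1}}{\sqrt{s}}+B_2\rho,$$ where $A_1,B_1,A_2,B_2$ depend only on $\delta_{2s}$ and $\gamma$. Additionally, $A$ satisfies $\omega$-NSP of order $s$ with null space constant $\frac{\delta_{2s}}{\gamma-(\gamma+1)\delta_{2s}}$.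
   Context: $[N]=\{1,\dots,N\}$; $\|x\|_{\omega,1}=\sum_{j=1}^N\omega_j|x_j|$; for $S\subset[N]$, $x_S$ equals $x$ on $S$ and is zero elsewhere, and $S^c=[N]\setminus S$. Here the sparsity of a set is its cardinality $|S|$. Standing assumption: $s\ge2$. RIP: the constant $\delta_{k}$ of $A$ is the smallest number such that $(1-\delta_k)\|x\|_2^2\le\|Ax\|_2^2\le(1+\delta_k)\|x\|_2^2$ for every $x\in\mathbb{C}^N$ with at most $k$ nonzero entries. $\sigma_s(x)_{\omega,1}=\inf\{\|x-z\|_{\omega,1}: z\in\mathbb{C}^N,\ |\operatorname{supp}z|\le s\}$. $A$ satisfies $\omega$-NSP of order $s$ with null space constant $\theta$ if $\|v_S\|_{\omega,1}\le\theta\|v_{S^c}\|_{\omega,1}$ for all $v\in\ker(A)$ and all $S\subset[N]$ with $|S|\le s$. *)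

theory Defs
  imports "HOL-Analysis.L2_Norm" "Jordan_Normal_Form.Matrix_Kernel"
begin

text \<open>Vectors and matrices are those of Jordan_Normal_Form, whose dimensions are values: the
  constants of the recovery bounds have to be chosen before the dimensions. Indices are
  0-based, so the index set \<open>{1,...,N}\<close> becomes \<open>{..<N}\<close>.\<close>

definition l2_norm :: "complex vec \<Rightarrow> real" where
  "l2_norm x = L2_set (\<lambda>i. cmod (x $ i)) {..<dim_vec x}"

definition wl1_norm :: "real vec \<Rightarrow> complex vec \<Rightarrow> real" where
  "wl1_norm \<omega> x = (\<Sum>j<dim_vec x. \<omega> $ j * cmod (x $ j))"

definition vec_supp :: "complex vec \<Rightarrow> nat set" where
  "vec_supp x = {i. i < dim_vec x \<and> x $ i \<noteq> 0}"

definition vec_restrict :: "complex vec \<Rightarrow> nat set \<Rightarrow> complex vec" where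
  "vec_restrict x S = vec (dim_vec x) (\<lambda>i. if i \<in> S then x $ i else 0)"

definition rip_bound :: "complex mat \<Rightarrow> nat \<Rightarrow> real \<Rightarrow> bool" where
  "rip_bound A k \<delta> \<longleftrightarrow>
     (\<forall>x \<in> carrier_vec (dim_col A). card (vec_supp x) \<le> k \<longrightarrow>
        (1 - \<delta>) * (l2_norm x)\<^sup>2 \<le> (l2_norm (A *\<^sub>v x))\<^sup>2 \<and>
        (l2_norm (A *\<^sub>v x))\<^sup>2 \<le> (1 + \<delta>) * (l2_norm x)\<^sup>2)"

text \<open>The least element exists as soon as \<open>k \<ge> 1\<close> and \<open>A\<close> has a column: the admissible
  \<open>\<delta>\<close> form a nonempty closed set of nonnegative reals. There is no restriction \<open>k \<le> dim_col A\<close>.\<close>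

definition rip_const :: "complex mat \<Rightarrow> nat \<Rightarrow> real" where
  "rip_const A k = (LEAST \<delta>. rip_bound A k \<delta>)"

definition best_approx_error :: "nat \<Rightarrow> real vec \<Rightarrow> complex vec \<Rightarrow> real" where
  "best_approx_error s \<omega> x =
     (INF z \<in> {z \<in> carrier_vec (dim_vec x). card (vec_supp z) \<le> s}. wl1_norm \<omega> (x - z))"

definition weighted_nsp :: "real vec \<Rightarrow> complex mat \<Rightarrow> nat \<Rightarrow> real \<Rightarrow> bool" where
  "weighted_nsp \<omega> A s \<theta> \<longleftrightarrow>
     (\<forall>v \<in> mat_kernel A. \<forall>S \<subseteq> {..<dim_col A}. card S \<le> s \<longrightarrow>
        wl1_norm \<omega> (vec_restrict v S) \<le> \<theta> * wl1_norm \<omega> (vec_restrict v ({..<dim_col A} - S)))"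

text \<open>Minimizers need not be unique, so being a solution is a predicate.\<close>

definition weighted_l1_solution ::
    "real vec \<Rightarrow> complex mat \<Rightarrow> complex vec \<Rightarrow> real \<Rightarrow> complex vec \<Rightarrow> bool" where
  "weighted_l1_solution \<omega> A y \<rho> xh \<longleftrightarrow>
     is_arg_min (wl1_norm \<omega>)
       (\<lambda>z. z \<in> carrier_vec (dim_col A) \<and> l2_norm (A *\<^sub>v z - y) \<le> \<rho>) xh"

end

theory Submission
  imports Defs
begin

text \<open>
  Let \<open>v\<close> be a vector, \<open>S\<close> the set of its \<open>s\<close> entries of largest modulus, and cut the remaining
  entries into blocks of \<open>s\<close> entries of decreasing size. Since each entry of a block is at most the
  average over the previous block, the \<open>\<ell>\<^sub>2\<close> norms of these blocks add up to at most
  \<open>\<parallel>v\<parallel>\<^sub>1 / \<surd>s\<close> (\<open>subadditive_tail_bound\<close>). The restricted isometry property of order \<open>2 s\<close> makes the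
  images of \<open>v\<^sub>S\<close> and of each block almost orthogonal, with constant \<open>\<delta>\<close>
  (\<open>rip_bound_re_inner_le\<close>). Together (\<open>rip_tail_bounds\<close>) they give
  \<open>(1 - \<delta>) \<parallel>v\<^sub>S\<parallel>\<^sub>2 \<le> \<delta> \<parallel>v\<parallel>\<^sub>1 / \<surd>s + \<surd>(1 + \<delta>) \<parallel>A v\<parallel>\<^sub>2\<close>.

  Every set of at most \<open>s\<close> indices carries at most the \<open>\<ell>\<^sub>2\<close> norm of \<open>v\<^sub>S\<close>. As the weights lie
  in \<open>[\<gamma>, 1]\<close>, the weighted norm is at most \<open>\<parallel>v\<parallel>\<^sub>1\<close> and at least \<open>\<gamma> \<parallel>v\<parallel>\<^sub>1\<close>, so
  \<open>robust_weighted_nsp\<close> follows: a null space inequality with constant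
  \<open>\<delta> / (\<gamma> - (\<gamma> + 1) \<delta>)\<close> and an error term proportional to \<open>\<surd>s \<parallel>A v\<parallel>\<^sub>2\<close>. On the kernel
  of \<open>A\<close> it is the null space property. For the difference \<open>v\<close> of \<open>x\<close> and a minimizer,
  \<open>\<parallel>A v\<parallel>\<^sub>2 \<le> 2 \<rho>\<close>, and minimality bounds \<open>v\<close> off the support of a sparse approximation by \<open>v\<close> on
  that support plus twice the approximation error. As the null space constant is less than 1, the
  two inequalities can be solved for the weighted norm of \<open>v\<close> (\<open>weighted_l1_error\<close>). The \<open>\<ell>\<^sub>2\<close>
  bound adds the block estimates to the bound on \<open>v\<^sub>S\<close>.

  All this holds for every admissible \<open>\<delta>\<close> below the threshold. The least one is admissible because
  the admissible \<open>\<delta>\<close> are nonempty, closed and bounded below (\<open>rip_bound_rip_const\<close>).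
\<close>

section \<open>Blocks of a nonnegative family\<close>

lemma L2_set_power2: "(L2_set f A)\<^sup>2 = (\<Sum>i\<in>A. (f i)\<^sup>2)"
  by (simp add: L2_set_def sum_nonneg)

lemma sum_le_sqrt_card_L2_set:
  assumes "finite A" "card A \<le> s"
  shows "sum f A \<le> sqrt (real s) * L2_set f A"
proof -
  have "sum f A \<le> (\<Sum>i\<in>A. \<bar>1 :: real\<bar> * \<bar>f i\<bar>)" by (intro sum_mono) auto
  also have "\<dots> \<le> L2_set (\<lambda>_. 1) A * L2_set f A" by (rule L2_set_mult_ineq)
  also have "L2_set (\<lambda>_. 1 :: real) A = sqrt (real (card A))" by (simp add: L2_set_def)
  also have "\<dots> * L2_set f A \<le> sqrt (real s) * L2_set f A"
    using assms by (intro mult_right_mono) auto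
  finally show ?thesis .
qed

lemma L2_set_le_sqrt_card_bound:
  assumes "card A \<le> s" and "\<And>i. i \<in> A \<Longrightarrow> 0 \<le> f i \<and> f i \<le> M" and "0 \<le> M"
  shows "L2_set f A \<le> sqrt (real s) * M"
proof -
  have "(\<Sum>i\<in>A. (f i)\<^sup>2) \<le> (\<Sum>i\<in>A. M\<^sup>2)"
    using assms by (intro sum_mono power_mono) auto
  also have "\<dots> \<le> real s * M\<^sup>2" using assms(1) by (simp add: mult_right_mono)
  finally have "L2_set f A \<le> sqrt (real s * M\<^sup>2)" by (simp add: L2_set_def)
  then show ?thesis using assms(3) by (simp add: real_sqrt_mult)
qed

text \<open>The set of the \<open>s\<close> largest entries. It is obtained as a set of full size
  \<open>min s (card U)\<close> with maximal \<open>\<ell>\<^sub>2\<close> norm, so it also dominates every other set of at most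
  \<open>s\<close> entries in \<open>\<ell>\<^sub>2\<close> norm.\<close>

lemma ex_largest_entries:
  fixes a :: "'a \<Rightarrow> real"
  assumes fin: "finite U" and nonneg: "\<And>i. i \<in> U \<Longrightarrow> 0 \<le> a i"
  shows "\<exists>S\<subseteq>U. card S = min s (card U) \<and> (\<forall>i\<in>S. \<forall>j\<in>U - S. a j \<le> a i) \<and>
    (\<forall>R\<subseteq>U. card R \<le> s \<longrightarrow> L2_set a R \<le> L2_set a S)"
proof -
  define n where "n = min s (card U)"
  define C where "C = {S. S \<subseteq> U \<and> card S = n}"
  have finC: "finite C" using fin by (auto simp: C_def)
  have "n \<le> card U" by (simp add: n_def)
  then obtain T where "T \<subseteq> U" "card T = n" by (rule obtain_subset_with_card_n)
  then have "C \<noteq> {}" by (auto simp: C_def)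
  then have "Max (L2_set a ` C) \<in> L2_set a ` C" using finC by (intro Max_in) auto
  then obtain S where S0: "S \<in> C" "Max (L2_set a ` C) = L2_set a S" by blast
  have S: "S \<in> C" "\<And>T. T \<in> C \<Longrightarrow> L2_set a T \<le> L2_set a S"
    using S0 finC Max_ge[of "L2_set a ` C"] by auto
  have SU: "S \<subseteq> U" and cS: "card S = n" using S(1) by (auto simp: C_def)
  have finS: "finite S" using SU fin finite_subset by blast
  have "a j \<le> a i" if i: "i \<in> S" and j: "j \<in> U - S" for i j
  proof -
    \<comment> \<open>Exchanging \<open>i\<close> for \<open>j\<close> cannot increase the maximal \<open>\<ell>\<^sub>2\<close> norm.\<close>
    define T where "T = insert j (S - {i})"
    have "card T = Suc (card (S - {i}))" using finS j by (auto simp: T_def)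
    then have "card T = n" using card_Suc_Diff1[OF finS i] cS by simp
    then have "T \<in> C" using SU j by (auto simp: C_def T_def)
    then have "(L2_set a T)\<^sup>2 \<le> (L2_set a S)\<^sup>2"
      using S(2) by (simp add: power_mono)
    moreover have "(L2_set a T)\<^sup>2 = (a j)\<^sup>2 + (\<Sum>k\<in>S - {i}. (a k)\<^sup>2)"
      using finS j by (simp add: L2_set_power2 T_def add_nonneg_nonneg sum_nonneg)
    moreover have "(L2_set a S)\<^sup>2 = (a i)\<^sup>2 + (\<Sum>k\<in>S - {i}. (a k)\<^sup>2)"
      by (simp add: L2_set_power2 sum.remove[OF finS i])
    ultimately have "(a j)\<^sup>2 \<le> (a i)\<^sup>2" by simp
    moreover have "0 \<le> a i" using nonneg i SU by blast
    ultimately show ?thesis by (rule power2_le_imp_le)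
  qed
  moreover have "L2_set a R \<le> L2_set a S" if R: "R \<subseteq> U" "card R \<le> s" for R
  proof -
    have "card R \<le> n" using R fin by (simp add: n_def card_mono)
    then obtain T where T: "R \<subseteq> T" "T \<subseteq> U" "card T = n"
      using exists_subset_between[of R n U] R fin \<open>n \<le> card U\<close> by auto
    have "L2_set a R \<le> L2_set a T"
      unfolding L2_set_def using T fin finite_subset[of T U] by (auto intro!: sum_mono2)
    also have "\<dots> \<le> L2_set a S" using T S(2) by (auto simp: C_def)
    finally show ?thesis .
  qed
  ultimately show ?thesis using SU cS unfolding n_def by blast
qed

lemma next_block_bound:
  fixes a :: "'a \<Rightarrow> real"
  assumes "card S = s" "1 \<le> s" and "\<And>i. i \<in> S \<Longrightarrow> b \<le> a i"
  shows "sqrt (real s) * b \<le> sum a S / sqrt (real s)"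
proof -
  have "real s * b \<le> sum a S"
    using sum_bounded_below[of S b a] assms by simp
  then have "sqrt (real s) * (sqrt (real s) * b) \<le> sum a S"
    by (simp flip: mult.assoc)
  then show ?thesis using assms(2) by (simp add: field_simps)
qed

text \<open>The usual decomposition of \<open>T\<close> into blocks of \<open>s\<close> entries of decreasing size, without an
  explicit list of blocks: the induction removes the block of largest entries, and every entry of
  the remainder is at most the average over that block. The bound \<open>M\<close> only pays for the
  first block. The set function \<open>F\<close> will be an \<open>\<ell>\<^sub>2\<close> norm or an inner product.\<close>

lemma subadditive_block_bound:
  fixes a :: "'a \<Rightarrow> real" and F :: "'a set \<Rightarrow> real"
  assumes "finite T" and s: "1 \<le> s" and c: "0 \<le> c" and M: "0 \<le> M"
    and a: "\<And>j. j \<in> T \<Longrightarrow> 0 \<le> a j \<and> a j \<le> M"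
    and sub: "\<And>P Q. P \<subseteq> T \<Longrightarrow> Q \<subseteq> T \<Longrightarrow> P \<inter> Q = {} \<Longrightarrow> F (P \<union> Q) \<le> F P + F Q"
    and small: "\<And>P. P \<subseteq> T \<Longrightarrow> card P \<le> s \<Longrightarrow> F P \<le> c * L2_set a P"
  shows "F T \<le> c * (sqrt (real s) * M + sum a T / sqrt (real s))"
  using assms(1) M a sub small
proof (induction "card T" arbitrary: T M rule: less_induct)
  case less
  note fin = less.prems(1) and M = less.prems(2) and a = less.prems(3)
    and sub = less.prems(4) and small = less.prems(5)
  have nonneg: "0 \<le> sum a T / sqrt (real s)" using a by (auto intro!: sum_nonneg divide_nonneg_nonneg)
  show ?case
  proof (cases "card T \<le> s")
    case True
    have "F T \<le> c * L2_set a T" using small True by blast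
    also have "L2_set a T \<le> sqrt (real s) * M"
      using True a M by (intro L2_set_le_sqrt_card_bound) auto
    also have "\<dots> \<le> sqrt (real s) * M + sum a T / sqrt (real s)" using nonneg by simp
    finally show ?thesis using c by (simp add: mult_left_mono)
  next
    case False
    obtain S where S: "S \<subseteq> T" "card S = min s (card T)" "\<forall>i\<in>S. \<forall>j\<in>T - S. a j \<le> a i"
      using ex_largest_entries[OF fin, of a s] a by blast
    have cS: "card S = s" using S False by simp
    then have finS: "finite S" and neS: "S \<noteq> {}" using s by (auto intro: card_ge_0_finite)
    define b where "b = Min (a ` S)"
    have b: "b \<le> a i" if "i \<in> S" for i using finS that by (simp add: b_def)
    have "b \<in> a ` S" using finS neS unfolding b_def by (intro Min_in) auto
    then obtain i where i: "i \<in> S" "b = a i" by blast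
    have lt: "card (T - S) < card T"
      using S(1) neS fin by (intro psubset_card_mono) auto
    have "F (T - S) \<le> c * (sqrt (real s) * b + sum a (T - S) / sqrt (real s))"
    proof (rule less.hyps[OF lt])
      show "0 \<le> b" using i a S(1) by auto
      show "0 \<le> a j \<and> a j \<le> b" if "j \<in> T - S" for j
        using S(3) i that a by auto
    qed (use fin sub small in \<open>auto simp: subset_eq\<close>)
    also have "sqrt (real s) * b \<le> sum a S / sqrt (real s)"
      by (rule next_block_bound[OF cS s b])
    also have "sum a S / sqrt (real s) + sum a (T - S) / sqrt (real s) = sum a T / sqrt (real s)"
      using sum.subset_diff[OF S(1) fin, of a] by (simp add: add_divide_distrib)
    finally have tail: "F (T - S) \<le> c * (sum a T / sqrt (real s))" using c by (simp add: mult_left_mono)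
    have "F T \<le> F S + F (T - S)" using sub[of S "T - S"] S(1) by (simp add: Un_absorb1)
    moreover have "F S \<le> c * L2_set a S" using small S(1) cS by blast
    moreover have "c * L2_set a S \<le> c * (sqrt (real s) * M)"
      using cS a S(1) M c by (intro mult_left_mono L2_set_le_sqrt_card_bound) auto
    ultimately show ?thesis using tail by (simp add: distrib_left)
  qed
qed

text \<open>When a block \<open>S\<close> of largest entries precedes the tail, the first block of the tail is paid
  for by the entries in \<open>S\<close>, and the bound \<open>M\<close> disappears.\<close>

lemma subadditive_tail_bound:
  fixes a :: "'a \<Rightarrow> real" and F :: "'a set \<Rightarrow> real"
  assumes fin: "finite U" and s: "1 \<le> s" and c: "0 \<le> c" and a: "\<And>j. j \<in> U \<Longrightarrow> 0 \<le> a j"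
    and S: "S \<subseteq> U" "card S = min s (card U)"
      "\<forall>i\<in>S. \<forall>j\<in>U - S. a j \<le> a i"
    and sub: "\<And>P Q. P \<subseteq> U - S \<Longrightarrow> Q \<subseteq> U - S \<Longrightarrow> P \<inter> Q = {} \<Longrightarrow> F (P \<union> Q) \<le> F P + F Q"
    and small: "\<And>P. P \<subseteq> U - S \<Longrightarrow> card P \<le> s \<Longrightarrow> F P \<le> c * L2_set a P"
  shows "F (U - S) \<le> c * (sum a U / sqrt (real s))"
proof (cases "U - S = {}")
  case True
  have "F {} \<le> c * L2_set a {}" using small[of "{}"] by simp
  moreover have "0 \<le> sum a U / sqrt (real s)" using a by (auto intro!: sum_nonneg divide_nonneg_nonneg)
  ultimately show ?thesis unfolding True
    using mult_nonneg_nonneg[OF c] by fastforce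
next
  case False
  have cS: "card S = s"
    using S(1,2) False card_subset_eq[OF fin S(1)] by (auto simp: min_def split: if_splits)
  then have finS: "finite S" and neS: "S \<noteq> {}" using s by (auto intro: card_ge_0_finite)
  define b where "b = Min (a ` S)"
  have b: "b \<le> a i" if "i \<in> S" for i using finS that by (simp add: b_def)
  have "b \<in> a ` S" using finS neS unfolding b_def by (intro Min_in) auto
  then obtain i where i: "i \<in> S" "b = a i" by blast
  have "F (U - S) \<le> c * (sqrt (real s) * b + sum a (U - S) / sqrt (real s))"
  proof (rule subadditive_block_bound[OF _ s c])
    show "0 \<le> b" using i a S(1) by auto
    show "0 \<le> a j \<and> a j \<le> b" if "j \<in> U - S" for j
      using S(3) i that a by auto
  qed (use fin sub small in auto)
  also have "sqrt (real s) * b \<le> sum a S / sqrt (real s)"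
    by (rule next_block_bound[OF cS s b])
  also have "sum a S / sqrt (real s) + sum a (U - S) / sqrt (real s) = sum a U / sqrt (real s)"
    using sum.subset_diff[OF S(1) fin, of a] by (simp add: add_divide_distrib)
  finally show ?thesis using c by (simp add: mult_left_mono)
qed

section \<open>Euclidean geometry of complex vectors\<close>

text \<open>The real part of the Hermitian inner product, that is, the inner product of the underlying
  real vector space. Polarization of \<open>l2_norm\<close> recovers only this part, and only it is
  needed. It is meant for vectors of equal dimension, and the summation range is that of the
  first one.\<close>

definition re_inner :: "complex vec \<Rightarrow> complex vec \<Rightarrow> real" where
  "re_inner u v = (\<Sum>i<dim_vec u. Re (u $ i * cnj (v $ i)))"

lemma l2_norm_nonneg: "0 \<le> l2_norm x"
  by (simp add: l2_norm_def)

lemma l2_norm_power2: "(l2_norm x)\<^sup>2 = (\<Sum>i<dim_vec x. (cmod (x $ i))\<^sup>2)"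
  by (simp add: l2_norm_def L2_set_power2)

lemma re_inner_self: "re_inner u u = (l2_norm u)\<^sup>2"
  unfolding re_inner_def l2_norm_power2
  by (intro sum.cong) (auto simp: cmod_power2 simp flip: power2_eq_square)

lemma re_inner_add_right:
  assumes "dim_vec v = dim_vec u" "dim_vec w = dim_vec u"
  shows "re_inner u (v + w) = re_inner u v + re_inner u w"
  using assms by (simp add: re_inner_def algebra_simps sum.distrib)

lemma re_inner_smult:
  assumes "dim_vec v = dim_vec u"
  shows "re_inner (complex_of_real a \<cdot>\<^sub>v u) (complex_of_real b \<cdot>\<^sub>v v) = a * b * re_inner u v"
  using assms by (simp add: re_inner_def sum_distrib_left algebra_simps)

lemma l2_norm_smult: "l2_norm (complex_of_real a \<cdot>\<^sub>v u) = \<bar>a\<bar> * l2_norm u"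
proof (rule power2_eq_imp_eq)
  show "(l2_norm (complex_of_real a \<cdot>\<^sub>v u))\<^sup>2 = (\<bar>a\<bar> * l2_norm u)\<^sup>2"
    by (simp add: l2_norm_power2 power_mult_distrib norm_mult sum_distrib_left)
qed (simp_all add: l2_norm_nonneg)

lemma l2_norm_add_power2:
  assumes "dim_vec v = dim_vec u"
  shows "(l2_norm (u + v))\<^sup>2 = (l2_norm u)\<^sup>2 + 2 * re_inner u v + (l2_norm v)\<^sup>2"
proof -
  have "(l2_norm (u + v))\<^sup>2
      = (\<Sum>i<dim_vec u. (cmod (u $ i))\<^sup>2 + 2 * Re (u $ i * cnj (v $ i)) + (cmod (v $ i))\<^sup>2)"
    unfolding l2_norm_power2 using assms
    by (intro sum.cong) (auto simp: cmod_power2 power2_sum)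
  then show ?thesis
    unfolding l2_norm_power2 re_inner_def using assms by (simp only: sum.distrib sum_distrib_left)
qed

lemma l2_norm_diff_power2:
  assumes "dim_vec v = dim_vec u"
  shows "(l2_norm (u - v))\<^sup>2 = (l2_norm u)\<^sup>2 - 2 * re_inner u v + (l2_norm v)\<^sup>2"
proof -
  have "(l2_norm (u - v))\<^sup>2
      = (\<Sum>i<dim_vec u. (cmod (u $ i))\<^sup>2 - 2 * Re (u $ i * cnj (v $ i)) + (cmod (v $ i))\<^sup>2)"
    unfolding l2_norm_power2 using assms
    by (intro sum.cong) (auto simp: cmod_power2 power2_diff)
  then show ?thesis
    unfolding l2_norm_power2 re_inner_def using assms
    by (simp only: sum.distrib sum_subtractf sum_distrib_left)
qed

lemma abs_re_inner_le:
  assumes "dim_vec v = dim_vec u"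
  shows "\<bar>re_inner u v\<bar> \<le> l2_norm u * l2_norm v"
proof -
  have "\<bar>re_inner u v\<bar> \<le> (\<Sum>i<dim_vec u. \<bar>cmod (u $ i)\<bar> * \<bar>cmod (v $ i)\<bar>)"
    unfolding re_inner_def
    by (rule order_trans[OF sum_abs])
      (auto intro!: sum_mono order_trans[OF abs_Re_le_cmod] simp: norm_mult simp del: times_complex.sel)
  also have "\<dots> \<le> l2_norm u * l2_norm v"
    unfolding l2_norm_def assms by (rule L2_set_mult_ineq)
  finally show ?thesis .
qed

lemma l2_norm_diff_le:
  assumes "dim_vec v = dim_vec u"
  shows "l2_norm (u - v) \<le> l2_norm u + l2_norm v"
proof (rule power2_le_imp_le)
  show "(l2_norm (u - v))\<^sup>2 \<le> (l2_norm u + l2_norm v)\<^sup>2"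
    using abs_re_inner_le[OF assms] by (simp add: l2_norm_diff_power2[OF assms] power2_sum)
qed (simp add: l2_norm_nonneg)

lemma l2_norm_minus_commute:
  assumes "dim_vec v = dim_vec u"
  shows "l2_norm (u - v) = l2_norm (v - u)"
  using assms by (auto simp: l2_norm_def norm_minus_commute intro!: L2_set_cong)

lemma dim_vec_restrict [simp]: "dim_vec (vec_restrict v S) = dim_vec v"
  by (simp add: vec_restrict_def)

lemma vec_restrict_carrier [simp]: "v \<in> carrier_vec n \<Longrightarrow> vec_restrict v S \<in> carrier_vec n"
  by (intro carrier_vecI) auto

lemma vec_restrict_Un:
  assumes "S \<inter> T = {}"
  shows "vec_restrict v (S \<union> T) = vec_restrict v S + vec_restrict v T"
  using assms by (intro eq_vecI) (auto simp: vec_restrict_def)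

lemma vec_restrict_all: "vec_restrict v {..<dim_vec v} = v"
  by (auto simp: vec_restrict_def)

lemma l2_norm_vec_restrict:
  assumes "S \<subseteq> {..<dim_vec v}"
  shows "l2_norm (vec_restrict v S) = L2_set (\<lambda>i. cmod (v $ i)) S"
proof -
  have "(\<Sum>i<dim_vec v. (cmod (vec_restrict v S $ i))\<^sup>2) = (\<Sum>i\<in>S. (cmod (v $ i))\<^sup>2)"
    using assms by (intro sum.mono_neutral_cong_right) (auto simp: vec_restrict_def)
  then show ?thesis by (simp add: l2_norm_def L2_set_def)
qed

lemma wl1_norm_vec_restrict:
  assumes "S \<subseteq> {..<dim_vec v}"
  shows "wl1_norm \<omega> (vec_restrict v S) = (\<Sum>j\<in>S. \<omega> $ j * cmod (v $ j))"
  unfolding wl1_norm_def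
  using assms by (intro sum.mono_neutral_cong_right) (auto simp: vec_restrict_def)

lemma vec_supp_vec_restrict: "vec_supp (vec_restrict v S) \<subseteq> S"
  by (auto simp: vec_supp_def vec_restrict_def split: if_splits)

lemma finite_vec_supp: "finite (vec_supp v)"
  by (simp add: vec_supp_def)

section \<open>The restricted isometry constant\<close>

lemma l2_norm_mult_mat_vec_le:
  assumes x: "x \<in> carrier_vec (dim_col A)"
  shows "(l2_norm (A *\<^sub>v x))\<^sup>2
    \<le> (\<Sum>i<dim_row A. \<Sum>j<dim_col A. (cmod (A $$ (i, j)))\<^sup>2) * (l2_norm x)\<^sup>2"
proof -
  have "(cmod ((A *\<^sub>v x) $ i))\<^sup>2 \<le> (\<Sum>j<dim_col A. (cmod (A $$ (i, j)))\<^sup>2) * (l2_norm x)\<^sup>2"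
    if i: "i < dim_row A" for i
  proof -
    have "cmod ((A *\<^sub>v x) $ i) = cmod (\<Sum>j<dim_col A. A $$ (i, j) * x $ j)"
      using i x by (simp add: scalar_prod_def lessThan_atLeast0)
    also have "\<dots> \<le> (\<Sum>j<dim_col A. \<bar>cmod (A $$ (i, j))\<bar> * \<bar>cmod (x $ j)\<bar>)"
      by (rule order_trans[OF norm_sum]) (simp add: norm_mult)
    also have "\<dots> \<le> L2_set (\<lambda>j. cmod (A $$ (i, j))) {..<dim_col A} * l2_norm x"
      unfolding l2_norm_def carrier_vecD[OF x] by (rule L2_set_mult_ineq)
    finally have "(cmod ((A *\<^sub>v x) $ i))\<^sup>2
        \<le> (L2_set (\<lambda>j. cmod (A $$ (i, j))) {..<dim_col A} * l2_norm x)\<^sup>2"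
      by (rule power_mono) simp
    then show ?thesis by (simp add: power_mult_distrib L2_set_power2)
  qed
  then show ?thesis by (auto simp: l2_norm_power2[of "A *\<^sub>v x"] sum_distrib_right intro!: sum_mono)
qed

text \<open>With \<open>C\<close> the squared Frobenius norm of \<open>A\<close>, the constant \<open>1 + C\<close> is admissible for every
  sparsity: the lower bound becomes trivial.\<close>

lemma rip_bound_exists: "\<exists>\<delta>. rip_bound A k \<delta>"
proof -
  define C where "C = (\<Sum>i<dim_row A. \<Sum>j<dim_col A. (cmod (A $$ (i, j)))\<^sup>2)"
  have "0 \<le> C" by (simp add: C_def sum_nonneg)
  have "rip_bound A k (1 + C)"
    unfolding rip_bound_def
  proof (intro ballI impI conjI)
    fix x :: "complex vec" assume x: "x \<in> carrier_vec (dim_col A)"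
    have "(1 - (1 + C)) * (l2_norm x)\<^sup>2 \<le> 0" using \<open>0 \<le> C\<close> by simp
    then show "(1 - (1 + C)) * (l2_norm x)\<^sup>2 \<le> (l2_norm (A *\<^sub>v x))\<^sup>2"
      by (rule order_trans) simp
    have "(l2_norm (A *\<^sub>v x))\<^sup>2 \<le> C * (l2_norm x)\<^sup>2"
      using l2_norm_mult_mat_vec_le[OF x] by (simp add: C_def)
    also have "\<dots> \<le> (1 + (1 + C)) * (l2_norm x)\<^sup>2" by (intro mult_right_mono) auto
    finally show "(l2_norm (A *\<^sub>v x))\<^sup>2 \<le> (1 + (1 + C)) * (l2_norm x)\<^sup>2" .
  qed
  then show ?thesis by blast
qed

lemma rip_bound_nonneg:
  assumes "rip_bound A k \<delta>" "1 \<le> k" "1 \<le> dim_col A"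
  shows "0 \<le> \<delta>"
proof -
  define x :: "complex vec" where "x = unit_vec (dim_col A) 0"
  have x: "x \<in> carrier_vec (dim_col A)" by (simp add: x_def)
  have "vec_supp x \<subseteq> {0}" by (auto simp: vec_supp_def x_def split: if_splits)
  then have "card (vec_supp x) \<le> 1" using card_mono[of "{0}" "vec_supp x"] by simp
  then have "card (vec_supp x) \<le> k" using assms(2) by simp
  then have "(1 - \<delta>) * (l2_norm x)\<^sup>2 \<le> (1 + \<delta>) * (l2_norm x)\<^sup>2"
    using assms(1) x unfolding rip_bound_def by (meson order_trans)
  moreover have "(l2_norm x)\<^sup>2 = 1"
  proof -
    have "(l2_norm x)\<^sup>2 = (\<Sum>i<dim_col A. if i = 0 then 1 else 0)"
      using assms(3) unfolding l2_norm_power2 x_def by (intro sum.cong) (auto simp: unit_vec_def)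
    then show ?thesis using assms(3) by simp
  qed
  ultimately show ?thesis by simp
qed

lemma rip_bound_Inf:
  assumes "1 \<le> k" "1 \<le> dim_col A"
  shows "rip_bound A k (Inf {\<delta>. rip_bound A k \<delta>})"
proof (subst rip_bound_def, intro ballI impI)
  let ?D = "{\<delta>. rip_bound A k \<delta>}"
  fix x :: "complex vec" assume x: "x \<in> carrier_vec (dim_col A)" "card (vec_supp x) \<le> k"
  define p q where "p = (l2_norm x)\<^sup>2" and "q = (l2_norm (A *\<^sub>v x))\<^sup>2"
  have rip: "(1 - \<delta>) * p \<le> q \<and> q \<le> (1 + \<delta>) * p" if "\<delta> \<in> ?D" for \<delta>
    using that x by (auto simp: rip_bound_def p_def q_def)
  have ne: "?D \<noteq> {}" using rip_bound_exists by blast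
  have "(1 - Inf ?D) * p \<le> q \<and> q \<le> (1 + Inf ?D) * p"
  proof (cases "p = 0")
    case True
    then show ?thesis using ne rip by fastforce
  next
    case False
    then have p: "0 < p" by (simp add: p_def)
    have "max (1 - q / p) (q / p - 1) \<le> Inf ?D"
      by (rule cInf_greatest[OF ne]) (use rip p in \<open>auto simp: field_simps\<close>)
    then show ?thesis using p by (simp add: field_simps)
  qed
  then show "(1 - Inf ?D) * (l2_norm x)\<^sup>2 \<le> (l2_norm (A *\<^sub>v x))\<^sup>2 \<and>
      (l2_norm (A *\<^sub>v x))\<^sup>2 \<le> (1 + Inf ?D) * (l2_norm x)\<^sup>2"
    by (simp add: p_def q_def)
qed

lemma rip_bound_rip_const:
  assumes "1 \<le> k" "1 \<le> dim_col A"
  shows "rip_bound A k (rip_const A k)"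
proof -
  have "bdd_below {\<delta>. rip_bound A k \<delta>}"
    using rip_bound_nonneg[OF _ assms] by (intro bdd_belowI[of _ 0]) auto
  then have "rip_const A k = Inf {\<delta>. rip_bound A k \<delta>}"
    unfolding rip_const_def
    by (intro Least_equality rip_bound_Inf[OF assms] cInf_lower) auto
  then show ?thesis using rip_bound_Inf[OF assms] by simp
qed

text \<open>RIP makes the images of disjointly supported vectors almost orthogonal: polarization gives
  the bound \<open>\<delta> (\<parallel>u\<parallel>\<^sup>2 + \<parallel>v\<parallel>\<^sup>2) / 2\<close>, and scaling turns the arithmetic mean into the product of
  the norms.\<close>

lemma rip_bound_re_inner_le:
  assumes rip: "rip_bound A k \<delta>" and \<delta>: "0 \<le> \<delta>"
    and u: "u \<in> carrier_vec (dim_col A)" and v: "v \<in> carrier_vec (dim_col A)"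
    and disj: "vec_supp u \<inter> vec_supp v = {}"
    and k: "card (vec_supp u) + card (vec_supp v) \<le> k"
  shows "\<bar>re_inner (A *\<^sub>v u) (A *\<^sub>v v)\<bar> \<le> \<delta> * l2_norm u * l2_norm v"
proof -
  have unscaled: "re_inner (A *\<^sub>v u) (A *\<^sub>v v) \<le> \<delta> / 2 * ((l2_norm u)\<^sup>2 + (l2_norm v)\<^sup>2)"
    if u: "u \<in> carrier_vec (dim_col A)" and v: "v \<in> carrier_vec (dim_col A)"
    and disj: "vec_supp u \<inter> vec_supp v = {}"
    and k: "card (vec_supp u) + card (vec_supp v) \<le> k" for u v
  proof -
    have dim: "dim_vec v = dim_vec u" using u v by simp
    have "card (vec_supp u \<union> vec_supp v) \<le> k" by (rule order_trans[OF card_Un_le k])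
    moreover have "vec_supp (u + v) \<subseteq> vec_supp u \<union> vec_supp v"
        "vec_supp (u - v) \<subseteq> vec_supp u \<union> vec_supp v"
      using dim by (auto simp: vec_supp_def)
    ultimately have "card (vec_supp (u + v)) \<le> k" "card (vec_supp (u - v)) \<le> k"
      by (meson card_mono finite_UnI finite_vec_supp order_trans)+
    then have "(l2_norm (A *\<^sub>v (u + v)))\<^sup>2 \<le> (1 + \<delta>) * (l2_norm (u + v))\<^sup>2"
      "(1 - \<delta>) * (l2_norm (u - v))\<^sup>2 \<le> (l2_norm (A *\<^sub>v (u - v)))\<^sup>2"
      using rip u v by (auto simp: rip_bound_def)
    moreover have "A *\<^sub>v (u + v) = A *\<^sub>v u + A *\<^sub>v v" "A *\<^sub>v (u - v) = A *\<^sub>v u - A *\<^sub>v v"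
      using u v mult_add_distrib_mat_vec[of A "dim_row A" "dim_col A" u v]
        mult_minus_distrib_mat_vec[of A "dim_row A" "dim_col A" u v] by auto
    moreover have "re_inner u v = 0"
      unfolding re_inner_def
    proof (intro sum.neutral ballI)
      fix i assume "i \<in> {..<dim_vec u}"
      then have "u $ i = 0 \<or> v $ i = 0" using disj dim by (auto simp: vec_supp_def)
      then show "Re (u $ i * cnj (v $ i)) = 0" by auto
    qed
    ultimately show ?thesis
      using dim by (simp add: l2_norm_add_power2 l2_norm_diff_power2 algebra_simps)
  qed
  have one_sided: "c * re_inner (A *\<^sub>v u) (A *\<^sub>v v) \<le> \<delta> * l2_norm u * l2_norm v"
    if c: "\<bar>c\<bar> = 1" for c :: real
  proof (cases "l2_norm u = 0 \<or> l2_norm v = 0")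
    case True
    have "card (vec_supp u) \<le> k" "card (vec_supp v) \<le> k" using k by auto
    then have "(l2_norm (A *\<^sub>v u))\<^sup>2 \<le> (1 + \<delta>) * (l2_norm u)\<^sup>2"
      "(l2_norm (A *\<^sub>v v))\<^sup>2 \<le> (1 + \<delta>) * (l2_norm v)\<^sup>2"
      using rip u v unfolding rip_bound_def by blast+
    then have "l2_norm (A *\<^sub>v u) = 0 \<or> l2_norm (A *\<^sub>v v) = 0"
      using True by auto
    then have "l2_norm (A *\<^sub>v u) * l2_norm (A *\<^sub>v v) = 0" by simp
    then have "re_inner (A *\<^sub>v u) (A *\<^sub>v v) = 0"
      using abs_re_inner_le[of "A *\<^sub>v v" "A *\<^sub>v u"] by (simp del: mult_eq_0_iff)
    then show ?thesis using True by auto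
  next
    case False
    then have pos: "0 < l2_norm u" "0 < l2_norm v"
      using l2_norm_nonneg by (simp_all add: less_le)
    \<comment> \<open>Rescale both vectors to the common norm \<open>\<parallel>u\<parallel>\<^sub>2 \<parallel>v\<parallel>\<^sub>2\<close>.\<close>
    define u' where "u' = complex_of_real (c * l2_norm v) \<cdot>\<^sub>v u"
    define v' where "v' = complex_of_real (l2_norm u) \<cdot>\<^sub>v v"
    have supp: "vec_supp u' \<subseteq> vec_supp u" "vec_supp v' \<subseteq> vec_supp v"
      by (auto simp: vec_supp_def u'_def v'_def)
    then have "card (vec_supp u') \<le> card (vec_supp u)" "card (vec_supp v') \<le> card (vec_supp v)"
      by (auto intro!: card_mono finite_vec_supp)
    then have "re_inner (A *\<^sub>v u') (A *\<^sub>v v') \<le> \<delta> / 2 * ((l2_norm u')\<^sup>2 + (l2_norm v')\<^sup>2)"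
      using k u v disj supp by (intro unscaled) (auto simp: u'_def v'_def)
    moreover have "re_inner (A *\<^sub>v u') (A *\<^sub>v v')
        = (l2_norm u * l2_norm v) * (c * re_inner (A *\<^sub>v u) (A *\<^sub>v v))"
      using mult_mat_vec[of A "dim_row A" "dim_col A" u] mult_mat_vec[of A "dim_row A" "dim_col A" v] u v
        re_inner_smult[of "A *\<^sub>v v" "A *\<^sub>v u" "c * l2_norm v" "l2_norm u"]
      by (simp add: u'_def v'_def)
    moreover have "\<delta> / 2 * ((l2_norm u')\<^sup>2 + (l2_norm v')\<^sup>2)
        = (l2_norm u * l2_norm v) * (\<delta> * l2_norm u * l2_norm v)"
      unfolding u'_def v'_def l2_norm_smult
      using c by (simp add: abs_mult l2_norm_nonneg power2_eq_square)
    ultimately have "(l2_norm u * l2_norm v) * (c * re_inner (A *\<^sub>v u) (A *\<^sub>v v))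
        \<le> (l2_norm u * l2_norm v) * (\<delta> * l2_norm u * l2_norm v)" by (simp only:)
    then show ?thesis using pos by simp
  qed
  show ?thesis using one_sided[of 1] one_sided[of "- 1"] by simp
qed

section \<open>Robust estimates under the restricted isometry property\<close>

text \<open>Here \<open>\<delta>\<close> is any admissible constant of order \<open>2 s\<close> in \<open>[0, 1)\<close>, not necessarily the least one.\<close>

locale rip_matrix =
  fixes A :: "complex mat" and m N s :: nat and \<delta> :: real
  assumes A: "A \<in> carrier_mat m N" and s: "1 \<le> s"
    and rip: "rip_bound A (2 * s) \<delta>" and \<delta>: "0 \<le> \<delta>" "\<delta> < 1"
begin

lemma dims [simp]: "dim_col A = N" "dim_row A = m"
  using A by auto

text \<open>The core estimate. With \<open>S\<close> the \<open>s\<close> largest entries of \<open>v\<close>, \<open>u = v\<^sub>S\<close> and \<open>w\<close> the rest of \<open>v\<close>,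
  \<open>(1 - \<delta>) \<parallel>u\<parallel>\<^sup>2 \<le> \<parallel>A u\<parallel>\<^sup>2 = \<langle>A u, A v\<rangle> - \<langle>A u, A w\<rangle>\<close>. The first term is controlled by
  Cauchy-Schwarz, the second one block by block by the almost orthogonality of images.\<close>

lemma rip_tail_bounds:
  assumes v: "v \<in> carrier_vec N"
  obtains S where "S \<subseteq> {..<N}"
    "\<forall>R\<subseteq>{..<N}. card R \<le> s \<longrightarrow>
      l2_norm (vec_restrict v R) \<le> l2_norm (vec_restrict v S)"
    "l2_norm (vec_restrict v ({..<N} - S)) \<le> (\<Sum>j<N. cmod (v $ j)) / sqrt (real s)"
    "(1 - \<delta>) * l2_norm (vec_restrict v S)
      \<le> \<delta> * ((\<Sum>j<N. cmod (v $ j)) / sqrt (real s)) + sqrt (1 + \<delta>) * l2_norm (A *\<^sub>v v)"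
proof -
  define a where "a = (\<lambda>j. cmod (v $ j))"
  obtain S where S: "S \<subseteq> {..<N}" "card S = min s (card {..<N})"
      "\<forall>i\<in>S. \<forall>j\<in>{..<N} - S. a j \<le> a i"
    and S_max: "\<forall>R\<subseteq>{..<N}. card R \<le> s \<longrightarrow> L2_set a R \<le> L2_set a S"
    using ex_largest_entries[of "{..<N}" a s] by (auto simp: a_def)
  have l2: "l2_norm (vec_restrict v R) = L2_set a R" if "R \<subseteq> {..<N}" for R
    using that v by (simp add: l2_norm_vec_restrict a_def)
  have tail: "F ({..<N} - S) \<le> c * (sum a {..<N} / sqrt (real s))"
    if "0 \<le> c" "\<And>P Q. P \<subseteq> {..<N} - S \<Longrightarrow> Q \<subseteq> {..<N} - S \<Longrightarrow> P \<inter> Q = {} \<Longrightarrow> F (P \<union> Q) \<le> F P + F Q"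
      "\<And>P. P \<subseteq> {..<N} - S \<Longrightarrow> card P \<le> s \<Longrightarrow> F P \<le> c * L2_set a P" for F c
    by (rule subadditive_tail_bound[OF _ s that(1) _ S that(2,3)]) (simp_all add: a_def)
  \<comment> \<open>The factor 1 is spelled out to match the constant \<open>c\<close> of the tail bound.\<close>
  have "L2_set a ({..<N} - S) \<le> 1 * (sum a {..<N} / sqrt (real s))"
  proof (rule tail)
    fix P Q assume PQ: "P \<subseteq> {..<N} - S" "Q \<subseteq> {..<N} - S" "P \<inter> Q = {}"
    then have "finite P" "finite Q" using finite_subset by blast+
    then have "(L2_set a (P \<union> Q))\<^sup>2 = (L2_set a P)\<^sup>2 + (L2_set a Q)\<^sup>2"
      using PQ(3) by (simp add: L2_set_power2 sum.union_disjoint)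
    also have "\<dots> \<le> (L2_set a P + L2_set a Q)\<^sup>2" by (simp add: power2_sum)
    finally show "L2_set a (P \<union> Q) \<le> L2_set a P + L2_set a Q"
      by (rule power2_le_imp_le) simp
  qed simp_all
  then have l2_tail: "l2_norm (vec_restrict v ({..<N} - S)) \<le> sum a {..<N} / sqrt (real s)"
    by (simp add: l2)
  define u w where "u = vec_restrict v S" and "w = vec_restrict v ({..<N} - S)"
  have uw: "u \<in> carrier_vec N" "w \<in> carrier_vec N" using v by (simp_all add: u_def w_def)
  have "vec_restrict v (S \<union> ({..<N} - S)) = u + w"
    unfolding u_def w_def by (rule vec_restrict_Un) auto
  moreover have "S \<union> ({..<N} - S) = {..<dim_vec v}" using S(1) v by auto
  ultimately have "v = u + w" by (simp add: vec_restrict_all)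
  then have Av: "A *\<^sub>v v = A *\<^sub>v u + A *\<^sub>v w"
    using mult_add_distrib_mat_vec[OF A uw] by simp
  have card_supp: "card (vec_supp (vec_restrict v P)) \<le> card P" if "P \<subseteq> {..<N}" for P
    using that finite_subset[OF that] by (intro card_mono vec_supp_vec_restrict) auto
  have cS: "card S \<le> s" using S(2) by simp
  then have cu: "card (vec_supp u) \<le> s" using card_supp[OF S(1)] by (simp add: u_def)
  have "- re_inner (A *\<^sub>v u) (A *\<^sub>v vec_restrict v ({..<N} - S))
      \<le> (\<delta> * l2_norm u) * (sum a {..<N} / sqrt (real s))"
  proof (rule tail)
    fix P Q :: "nat set" assume PQ: "P \<inter> Q = {}"
    have "A *\<^sub>v vec_restrict v (P \<union> Q) = A *\<^sub>v vec_restrict v P + A *\<^sub>v vec_restrict v Q"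
      unfolding vec_restrict_Un[OF PQ] using v by (intro mult_add_distrib_mat_vec[OF A]) auto
    then show "- re_inner (A *\<^sub>v u) (A *\<^sub>v vec_restrict v (P \<union> Q))
        \<le> - re_inner (A *\<^sub>v u) (A *\<^sub>v vec_restrict v P) + - re_inner (A *\<^sub>v u) (A *\<^sub>v vec_restrict v Q)"
      by (simp add: re_inner_add_right)
  next
    fix P assume P: "P \<subseteq> {..<N} - S" "card P \<le> s"
    have "\<bar>re_inner (A *\<^sub>v u) (A *\<^sub>v vec_restrict v P)\<bar> \<le> \<delta> * l2_norm u * l2_norm (vec_restrict v P)"
    proof (rule rip_bound_re_inner_le[OF rip \<delta>(1)])
      show "vec_supp u \<inter> vec_supp (vec_restrict v P) = {}"
        using vec_supp_vec_restrict[of v S] vec_supp_vec_restrict[of v P] P(1) by (auto simp: u_def)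
      show "card (vec_supp u) + card (vec_supp (vec_restrict v P)) \<le> 2 * s"
        using cu card_supp[of P] P by force
    qed (use v uw in auto)
    moreover have "l2_norm (vec_restrict v P) = L2_set a P" using P(1) by (intro l2) auto
    ultimately show "- re_inner (A *\<^sub>v u) (A *\<^sub>v vec_restrict v P) \<le> \<delta> * l2_norm u * L2_set a P"
      by simp
  qed (simp add: \<delta>(1) l2_norm_nonneg)
  then have cross: "- re_inner (A *\<^sub>v u) (A *\<^sub>v w) \<le> (\<delta> * l2_norm u) * (sum a {..<N} / sqrt (real s))"
    by (simp only: w_def)
  have ripu: "(1 - \<delta>) * (l2_norm u)\<^sup>2 \<le> (l2_norm (A *\<^sub>v u))\<^sup>2"
    "(l2_norm (A *\<^sub>v u))\<^sup>2 \<le> (1 + \<delta>) * (l2_norm u)\<^sup>2"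
    using rip[unfolded rip_bound_def, rule_format, of u] uw(1) cu by simp_all
  have "l2_norm (A *\<^sub>v u) \<le> sqrt (1 + \<delta>) * l2_norm u"
    using ripu(2) \<delta>(1)
    by (intro power2_le_imp_le[of "l2_norm (A *\<^sub>v u)"]) (simp_all add: power_mult_distrib l2_norm_nonneg)
  then have Au: "l2_norm (A *\<^sub>v u) * l2_norm (A *\<^sub>v v) \<le> sqrt (1 + \<delta>) * l2_norm u * l2_norm (A *\<^sub>v v)"
    by (intro mult_right_mono) (auto simp: l2_norm_nonneg)
  have "re_inner (A *\<^sub>v u) (A *\<^sub>v v) = (l2_norm (A *\<^sub>v u))\<^sup>2 + re_inner (A *\<^sub>v u) (A *\<^sub>v w)"
    unfolding Av by (simp add: re_inner_add_right re_inner_self)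
  moreover have "re_inner (A *\<^sub>v u) (A *\<^sub>v v) \<le> l2_norm (A *\<^sub>v u) * l2_norm (A *\<^sub>v v)"
    using abs_re_inner_le[of "A *\<^sub>v v" "A *\<^sub>v u"] by simp
  ultimately have "(1 - \<delta>) * (l2_norm u)\<^sup>2
      \<le> sqrt (1 + \<delta>) * l2_norm u * l2_norm (A *\<^sub>v v) + (\<delta> * l2_norm u) * (sum a {..<N} / sqrt (real s))"
    using ripu(1) Au cross by linarith
  then have main: "l2_norm u * ((1 - \<delta>) * l2_norm u)
      \<le> l2_norm u * (\<delta> * (sum a {..<N} / sqrt (real s)) + sqrt (1 + \<delta>) * l2_norm (A *\<^sub>v v))"
    by (simp add: power2_eq_square algebra_simps)
  have "(1 - \<delta>) * l2_norm u \<le> \<delta> * (sum a {..<N} / sqrt (real s)) + sqrt (1 + \<delta>) * l2_norm (A *\<^sub>v v)"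
  proof (cases "l2_norm u = 0")
    case True
    have "0 \<le> sum a {..<N} / sqrt (real s)" by (simp add: a_def sum_nonneg)
    then have "0 \<le> \<delta> * (sum a {..<N} / sqrt (real s))" using \<delta>(1) by (rule mult_nonneg_nonneg[rotated])
    moreover have "0 \<le> sqrt (1 + \<delta>) * l2_norm (A *\<^sub>v v)" using \<delta>(1) by (simp add: l2_norm_nonneg)
    ultimately show ?thesis using True by simp
  next
    case False
    then have "0 < l2_norm u" using l2_norm_nonneg[of u] by simp
    with main show ?thesis by simp
  qed
  with l2_tail S(1) S_max show ?thesis
    by (intro that[of S]) (simp_all add: l2 a_def u_def)
qed

lemma rip_l1_restrict_le:
  assumes v: "v \<in> carrier_vec N" and R: "R \<subseteq> {..<N}" "card R \<le> s"
  shows "(1 - \<delta>) * (\<Sum>j\<in>R. cmod (v $ j))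
    \<le> \<delta> * (\<Sum>j<N. cmod (v $ j)) + sqrt (1 + \<delta>) * sqrt (real s) * l2_norm (A *\<^sub>v v)"
proof -
  obtain S where S: "l2_norm (vec_restrict v R) \<le> l2_norm (vec_restrict v S)"
    "(1 - \<delta>) * l2_norm (vec_restrict v S)
      \<le> \<delta> * ((\<Sum>j<N. cmod (v $ j)) / sqrt (real s)) + sqrt (1 + \<delta>) * l2_norm (A *\<^sub>v v)"
    using rip_tail_bounds[OF v] R by metis
  have "(\<Sum>j\<in>R. cmod (v $ j)) \<le> sqrt (real s) * l2_norm (vec_restrict v R)"
    using sum_le_sqrt_card_L2_set[OF finite_subset[OF R(1)] R(2)] R(1) v
    by (simp add: l2_norm_vec_restrict)
  also have "\<dots> \<le> sqrt (real s) * l2_norm (vec_restrict v S)" using S(1) by (simp add: mult_left_mono)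
  finally have "(1 - \<delta>) * (\<Sum>j\<in>R. cmod (v $ j)) \<le> sqrt (real s) * ((1 - \<delta>) * l2_norm (vec_restrict v S))"
    using \<delta>(2) by (simp add: mult.left_commute)
  also have "\<dots> \<le> sqrt (real s) *
      (\<delta> * ((\<Sum>j<N. cmod (v $ j)) / sqrt (real s)) + sqrt (1 + \<delta>) * l2_norm (A *\<^sub>v v))"
    by (rule mult_left_mono[OF S(2)]) simp
  also have "\<dots> = \<delta> * (\<Sum>j<N. cmod (v $ j)) + sqrt (1 + \<delta>) * sqrt (real s) * l2_norm (A *\<^sub>v v)"
    using s by (simp add: field_simps)
  finally show ?thesis .
qed

lemma rip_l2_norm_le:
  assumes v: "v \<in> carrier_vec N"
  shows "(1 - \<delta>) * l2_norm v
    \<le> (\<Sum>j<N. cmod (v $ j)) / sqrt (real s) + sqrt (1 + \<delta>) * l2_norm (A *\<^sub>v v)"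
proof -
  obtain S where S: "S \<subseteq> {..<N}"
    "l2_norm (vec_restrict v ({..<N} - S)) \<le> (\<Sum>j<N. cmod (v $ j)) / sqrt (real s)"
    "(1 - \<delta>) * l2_norm (vec_restrict v S)
      \<le> \<delta> * ((\<Sum>j<N. cmod (v $ j)) / sqrt (real s)) + sqrt (1 + \<delta>) * l2_norm (A *\<^sub>v v)"
    using rip_tail_bounds[OF v] by metis
  have "(l2_norm v)\<^sup>2 = (\<Sum>i\<in>S. (cmod (v $ i))\<^sup>2) + (\<Sum>i\<in>{..<N} - S. (cmod (v $ i))\<^sup>2)"
    using v S(1) by (simp add: l2_norm_power2 sum.subset_diff)
  also have "\<dots> = (l2_norm (vec_restrict v S))\<^sup>2 + (l2_norm (vec_restrict v ({..<N} - S)))\<^sup>2"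
    using v S(1) by (simp add: l2_norm_vec_restrict L2_set_power2 subset_eq)
  also have "\<dots> \<le> (l2_norm (vec_restrict v S) + l2_norm (vec_restrict v ({..<N} - S)))\<^sup>2"
    by (simp add: power2_sum l2_norm_nonneg)
  finally have "l2_norm v \<le> l2_norm (vec_restrict v S) + l2_norm (vec_restrict v ({..<N} - S))"
    by (rule power2_le_imp_le) (simp add: l2_norm_nonneg)
  then have "(1 - \<delta>) * l2_norm v
      \<le> (1 - \<delta>) * l2_norm (vec_restrict v S) + (1 - \<delta>) * l2_norm (vec_restrict v ({..<N} - S))"
    using mult_left_mono[of _ _ "1 - \<delta>"] \<delta>(2) by (fastforce simp flip: distrib_left)
  moreover have "(1 - \<delta>) * l2_norm (vec_restrict v ({..<N} - S))
      \<le> (1 - \<delta>) * ((\<Sum>j<N. cmod (v $ j)) / sqrt (real s))"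
    using mult_left_mono[OF S(2), of "1 - \<delta>"] \<delta>(2) by simp
  ultimately show ?thesis
    using S(3) left_diff_distrib[of 1 \<delta> "(\<Sum>j<N. cmod (v $ j)) / sqrt (real s)"] by linarith
qed

end

section \<open>Weighted null space property and recovery\<close>

text \<open>The upper bound on \<open>\<delta>\<close> is equivalent to \<open>\<delta> < \<gamma> - (\<gamma> + 1) \<delta>\<close>, so the null space
  constant \<open>\<delta> / (\<gamma> - (\<gamma> + 1) \<delta>)\<close> has a positive denominator and is less than 1.\<close>

locale weighted_rip_matrix = rip_matrix +
  fixes \<gamma> :: real and \<omega> :: "real vec"
  assumes \<gamma>: "0 < \<gamma>" "\<gamma> < 1"
    and \<omega>: "\<And>j. j < N \<Longrightarrow> \<gamma> \<le> \<omega> $ j" "\<And>j. j < N \<Longrightarrow> \<omega> $ j \<le> 1"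
    and \<delta>_less: "\<delta> < \<gamma> / (\<gamma> + 2)"
begin

lemma gap_pos: "0 < \<gamma> - (\<gamma> + 2) * \<delta>"
  using \<delta>_less \<gamma> by (simp add: field_simps)

lemma l1_le_weighted: "\<gamma> * (\<Sum>j<N. cmod (v $ j)) \<le> (\<Sum>j<N. \<omega> $ j * cmod (v $ j))"
  unfolding sum_distrib_left using \<omega>(1) by (intro sum_mono mult_right_mono) auto

text \<open>The null space inequality for arbitrary \<open>v\<close>, with an error term that vanishes on the kernel.
  The weights enter twice: \<open>\<omega> \<le> 1\<close> passes to the unweighted norm on \<open>S\<close>, and \<open>\<omega> \<ge> \<gamma>\<close>
  passes back to the weighted norm on the whole vector at the price of a factor \<open>1 / \<gamma>\<close>.\<close>

lemma robust_weighted_nsp: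
  assumes v: "v \<in> carrier_vec N" and S: "S \<subseteq> {..<N}" "card S \<le> s"
  shows "(\<gamma> - (\<gamma> + 1) * \<delta>) * (\<Sum>j\<in>S. \<omega> $ j * cmod (v $ j))
    \<le> \<delta> * (\<Sum>j\<in>{..<N} - S. \<omega> $ j * cmod (v $ j))
      + \<gamma> * sqrt (1 + \<delta>) * sqrt (real s) * l2_norm (A *\<^sub>v v)"
proof -
  define p q E where "p = (\<Sum>j\<in>S. \<omega> $ j * cmod (v $ j))"
    and "q = (\<Sum>j\<in>{..<N} - S. \<omega> $ j * cmod (v $ j))"
    and "E = sqrt (1 + \<delta>) * sqrt (real s) * l2_norm (A *\<^sub>v v)"
  have "p \<le> (\<Sum>j\<in>S. 1 * cmod (v $ j))"
    unfolding p_def using \<omega>(2) S(1) by (intro sum_mono mult_right_mono) auto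
  then have "(1 - \<delta>) * p \<le> (1 - \<delta>) * (\<Sum>j\<in>S. cmod (v $ j))" using \<delta>(2) by simp
  also have "\<dots> \<le> \<delta> * (\<Sum>j<N. cmod (v $ j)) + E"
    using rip_l1_restrict_le[OF v S] by (simp add: E_def)
  finally have "\<gamma> * ((1 - \<delta>) * p) \<le> \<gamma> * (\<delta> * (\<Sum>j<N. cmod (v $ j)) + E)"
    using \<gamma>(1) by simp
  also have "\<dots> = \<delta> * (\<gamma> * (\<Sum>j<N. cmod (v $ j))) + \<gamma> * E" by (simp add: algebra_simps)
  also have "\<dots> \<le> \<delta> * (\<Sum>j<N. \<omega> $ j * cmod (v $ j)) + \<gamma> * E"
    using l1_le_weighted \<delta>(1) by (simp add: mult_left_mono)
  also have "(\<Sum>j<N. \<omega> $ j * cmod (v $ j)) = p + q"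
    unfolding p_def q_def using S(1) by (simp add: sum.subset_diff)
  finally have "(\<gamma> - (\<gamma> + 1) * \<delta>) * p \<le> \<delta> * q + \<gamma> * E" by (simp add: algebra_simps)
  then show ?thesis by (simp add: p_def q_def E_def mult.assoc)
qed

lemma weighted_nsp_rip: "weighted_nsp \<omega> A s (\<delta> / (\<gamma> - (\<gamma> + 1) * \<delta>))"
  unfolding weighted_nsp_def
proof (intro ballI allI impI)
  fix v S assume v: "v \<in> mat_kernel A" and S: "S \<subseteq> {..<dim_col A}" "card S \<le> s"
  have vN: "v \<in> carrier_vec N" and Av: "A *\<^sub>v v = 0\<^sub>v m"
    using v mat_kernelD[OF A] by auto
  have D: "0 < \<gamma> - (\<gamma> + 1) * \<delta>" using gap_pos \<delta>(1) by (simp add: algebra_simps)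
  have "l2_norm (A *\<^sub>v v) = 0" by (simp add: Av l2_norm_def L2_set_def)
  then have "(\<gamma> - (\<gamma> + 1) * \<delta>) * (\<Sum>j\<in>S. \<omega> $ j * cmod (v $ j))
      \<le> \<delta> * (\<Sum>j\<in>{..<N} - S. \<omega> $ j * cmod (v $ j))"
    using robust_weighted_nsp[OF vN] S by simp
  then have "(\<Sum>j\<in>S. \<omega> $ j * cmod (v $ j))
      \<le> \<delta> / (\<gamma> - (\<gamma> + 1) * \<delta>) * (\<Sum>j\<in>{..<N} - S. \<omega> $ j * cmod (v $ j))"
    using D by (simp add: pos_le_divide_eq mult.commute)
  then show "wl1_norm \<omega> (vec_restrict v S)
      \<le> \<delta> / (\<gamma> - (\<gamma> + 1) * \<delta>) * wl1_norm \<omega> (vec_restrict v ({..<dim_col A} - S))"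
    using S(1) vN by (simp add: wl1_norm_vec_restrict)
qed

text \<open>The comparison is with one sparse vector \<open>w\<close> at a time, so that it does not
  matter whether the infimum in \<open>best_approx_error\<close> is attained.\<close>

lemma weighted_l1_error:
  assumes x: "x \<in> carrier_vec N" and z: "z \<in> carrier_vec N"
    and w: "w \<in> carrier_vec N" "card (vec_supp w) \<le> s"
    and le: "wl1_norm \<omega> z \<le> wl1_norm \<omega> x"
    and E: "l2_norm (A *\<^sub>v (x - z)) \<le> 2 * \<rho>"
  shows "wl1_norm \<omega> (x - z) \<le> 2 * \<gamma> * (1 - \<delta>) / (\<gamma> - (\<gamma> + 2) * \<delta>) * wl1_norm \<omega> (x - w)
    + 4 * \<gamma> * sqrt (1 + \<delta>) / (\<gamma> - (\<gamma> + 2) * \<delta>) * sqrt (real s) * \<rho>"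
proof -
  define S where "S = vec_supp w"
  have S: "S \<subseteq> {..<N}" using w(1) by (auto simp: S_def vec_supp_def)
  define p q \<sigma> X where "p = (\<Sum>j\<in>S. \<omega> $ j * cmod ((x - z) $ j))"
    and "q = (\<Sum>j\<in>{..<N} - S. \<omega> $ j * cmod ((x - z) $ j))"
    and "\<sigma> = wl1_norm \<omega> (x - w)"
    and "X = \<gamma> * sqrt (1 + \<delta>) * sqrt (real s) * (2 * \<rho>)"
  have \<omega>0: "0 \<le> \<omega> $ j" if "j < N" for j using \<omega>(1)[OF that] \<gamma>(1) by simp
  have split: "sum f {..<N} = sum f S + sum f ({..<N} - S)" for f :: "nat \<Rightarrow> real"
    using S by (simp add: sum.subset_diff)
  have wl1: "wl1_norm \<omega> y = (\<Sum>j<N. \<omega> $ j * cmod (y $ j))" if "y \<in> carrier_vec N" for y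
    using that by (simp add: wl1_norm_def)
  have "(\<Sum>j\<in>{..<N} - S. \<omega> $ j * cmod (x $ j)) = (\<Sum>j\<in>{..<N} - S. \<omega> $ j * cmod ((x - w) $ j))"
    using x w(1) by (intro sum.cong) (auto simp: S_def vec_supp_def)
  also have "\<dots> \<le> (\<Sum>j<N. \<omega> $ j * cmod ((x - w) $ j))"
    using \<omega>0 by (intro sum_mono2) auto
  also have "\<dots> = \<sigma>" unfolding \<sigma>_def using x w(1) by (subst wl1) auto
  finally have tail: "(\<Sum>j\<in>{..<N} - S. \<omega> $ j * cmod (x $ j)) \<le> \<sigma>" .
  have "(\<Sum>j\<in>S. \<omega> $ j * cmod (x $ j)) \<le> (\<Sum>j\<in>S. \<omega> $ j * cmod (z $ j) + \<omega> $ j * cmod ((x - z) $ j))"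
  proof (rule sum_mono)
    fix j assume "j \<in> S"
    then have j: "j < N" using S by auto
    have "cmod (x $ j) \<le> cmod (z $ j) + cmod (x $ j - z $ j)"
      using norm_triangle_ineq[of "z $ j" "x $ j - z $ j"] by simp
    then show "\<omega> $ j * cmod (x $ j) \<le> \<omega> $ j * cmod (z $ j) + \<omega> $ j * cmod ((x - z) $ j)"
      using mult_left_mono[OF _ \<omega>0[OF j]] x z j by (fastforce simp flip: distrib_left)
  qed
  then have head: "(\<Sum>j\<in>S. \<omega> $ j * cmod (x $ j)) \<le> (\<Sum>j\<in>S. \<omega> $ j * cmod (z $ j)) + p"
    by (simp add: p_def sum.distrib)
  have "q \<le> (\<Sum>j\<in>{..<N} - S. \<omega> $ j * cmod (x $ j) + \<omega> $ j * cmod (z $ j))"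
    unfolding q_def
  proof (rule sum_mono)
    fix j assume "j \<in> {..<N} - S"
    then have j: "j < N" by auto
    have "cmod (x $ j - z $ j) \<le> cmod (x $ j) + cmod (z $ j)" by (rule norm_triangle_ineq4)
    then show "\<omega> $ j * cmod ((x - z) $ j) \<le> \<omega> $ j * cmod (x $ j) + \<omega> $ j * cmod (z $ j)"
      using mult_left_mono[OF _ \<omega>0[OF j]] x z j by (fastforce simp flip: distrib_left)
  qed
  then have "q \<le> (\<Sum>j\<in>{..<N} - S. \<omega> $ j * cmod (x $ j)) + (\<Sum>j\<in>{..<N} - S. \<omega> $ j * cmod (z $ j))"
    by (simp add: sum.distrib)
  \<comment> \<open>As the weighted norm of \<open>z\<close> is at most that of \<open>x\<close>, the error is concentrated on \<open>S\<close> up to \<open>2 \<sigma>\<close>.\<close>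
  then have cone: "q \<le> p + 2 * \<sigma>"
    using le head tail unfolding wl1[OF x] wl1[OF z] split by linarith
  have "(\<gamma> - (\<gamma> + 1) * \<delta>) * p
      \<le> \<delta> * q + \<gamma> * sqrt (1 + \<delta>) * sqrt (real s) * l2_norm (A *\<^sub>v (x - z))"
    using robust_weighted_nsp[of "x - z" S] x z w(2) S by (simp add: p_def q_def S_def)
  also have "\<gamma> * sqrt (1 + \<delta>) * sqrt (real s) * l2_norm (A *\<^sub>v (x - z)) \<le> X"
    unfolding X_def using E \<gamma>(1) \<delta>(1) by (intro mult_left_mono) auto
  also have "\<delta> * q \<le> \<delta> * (p + 2 * \<sigma>)" using cone \<delta>(1) by (rule mult_left_mono)
  finally have "(\<gamma> - (\<gamma> + 2) * \<delta>) * p \<le> 2 * \<delta> * \<sigma> + X" by (simp add: algebra_simps)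
  moreover have "wl1_norm \<omega> (x - z) = p + q"
    unfolding p_def q_def split[symmetric] using x z by (intro wl1) auto
  moreover have "(\<gamma> - (\<gamma> + 2) * \<delta>) * (p + q) \<le> (\<gamma> - (\<gamma> + 2) * \<delta>) * (2 * p + 2 * \<sigma>)"
    using cone gap_pos by (intro mult_left_mono) auto
  ultimately have "(\<gamma> - (\<gamma> + 2) * \<delta>) * wl1_norm \<omega> (x - z) \<le> 2 * \<gamma> * (1 - \<delta>) * \<sigma> + 2 * X"
    by (simp add: algebra_simps)
  then have "wl1_norm \<omega> (x - z) \<le> (2 * \<gamma> * (1 - \<delta>) * \<sigma> + 2 * X) / (\<gamma> - (\<gamma> + 2) * \<delta>)"
    using gap_pos by (simp add: pos_le_divide_eq mult.commute)
  then show ?thesis by (simp add: \<sigma>_def X_def add_divide_distrib mult.assoc)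
qed

lemma weighted_l2_error:
  assumes v: "v \<in> carrier_vec N" and E: "l2_norm (A *\<^sub>v v) \<le> 2 * \<rho>"
  shows "l2_norm v \<le> wl1_norm \<omega> v / (\<gamma> * (1 - \<delta>) * sqrt (real s)) + 2 * sqrt (1 + \<delta>) / (1 - \<delta>) * \<rho>"
proof -
  have "(\<Sum>j<N. cmod (v $ j)) \<le> wl1_norm \<omega> v / \<gamma>"
    using l1_le_weighted[of v] v \<gamma>(1) by (simp add: wl1_norm_def pos_le_divide_eq mult.commute)
  then have "(\<Sum>j<N. cmod (v $ j)) / sqrt (real s) \<le> wl1_norm \<omega> v / \<gamma> / sqrt (real s)"
    by (rule divide_right_mono) simp
  moreover have "sqrt (1 + \<delta>) * l2_norm (A *\<^sub>v v) \<le> sqrt (1 + \<delta>) * (2 * \<rho>)"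
    using E \<delta>(1) by (intro mult_left_mono) auto
  ultimately have "(1 - \<delta>) * l2_norm v \<le> wl1_norm \<omega> v / \<gamma> / sqrt (real s) + sqrt (1 + \<delta>) * (2 * \<rho>)"
    using rip_l2_norm_le[OF v] by linarith
  then have "l2_norm v \<le> (wl1_norm \<omega> v / \<gamma> / sqrt (real s) + sqrt (1 + \<delta>) * (2 * \<rho>)) / (1 - \<delta>)"
    using \<delta>(2) by (simp add: pos_le_divide_eq mult.commute)
  then show ?thesis by (simp add: add_divide_distrib ac_simps)
qed

lemma weighted_l1_recovery:
  assumes x: "x \<in> carrier_vec N" and e: "e \<in> carrier_vec m" "l2_norm e \<le> \<rho>"
    and sol: "weighted_l1_solution \<omega> A (A *\<^sub>v x + e) \<rho> z"
  shows "wl1_norm \<omega> (x - z)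
      \<le> 2 * \<gamma> * (1 - \<delta>) / (\<gamma> - (\<gamma> + 2) * \<delta>) * best_approx_error s \<omega> x
        + 4 * \<gamma> * sqrt (1 + \<delta>) / (\<gamma> - (\<gamma> + 2) * \<delta>) * sqrt (real s) * \<rho>"
    and "l2_norm (x - z)
      \<le> 2 / (\<gamma> - (\<gamma> + 2) * \<delta>) * (best_approx_error s \<omega> x / sqrt (real s))
        + (4 * sqrt (1 + \<delta>) / ((1 - \<delta>) * (\<gamma> - (\<gamma> + 2) * \<delta>)) + 2 * sqrt (1 + \<delta>) / (1 - \<delta>)) * \<rho>"
proof -
  let ?y = "A *\<^sub>v x + e"
  define D where "D = \<gamma> - (\<gamma> + 2) * \<delta>"
  have D: "0 < D" using gap_pos by (simp add: D_def)
  have z: "z \<in> carrier_vec N" and zfeas: "l2_norm (A *\<^sub>v z - ?y) \<le> \<rho>"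
    and min: "\<forall>w. w \<in> carrier_vec N \<and> l2_norm (A *\<^sub>v w - ?y) \<le> \<rho> \<longrightarrow> wl1_norm \<omega> z \<le> wl1_norm \<omega> w"
    using sol by (simp_all add: weighted_l1_solution_def is_arg_min_linorder)
  have Ax: "A *\<^sub>v x \<in> carrier_vec m" and Az: "A *\<^sub>v z \<in> carrier_vec m" using x z A by auto
  have "?y - A *\<^sub>v x = e" using Ax e(1) by (intro eq_vecI) auto
  then have xfeas: "l2_norm (A *\<^sub>v x - ?y) \<le> \<rho>"
    using l2_norm_minus_commute[of "A *\<^sub>v x" ?y] Ax e by simp
  have le: "wl1_norm \<omega> z \<le> wl1_norm \<omega> x" using min x xfeas by blast
  have "A *\<^sub>v (x - z) = A *\<^sub>v x - A *\<^sub>v z"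
    by (rule mult_minus_distrib_mat_vec[OF A x z])
  also have "\<dots> = (A *\<^sub>v x - ?y) - (A *\<^sub>v z - ?y)"
    using Ax Az e(1) by (intro eq_vecI) auto
  also have "l2_norm \<dots> \<le> l2_norm (A *\<^sub>v x - ?y) + l2_norm (A *\<^sub>v z - ?y)"
    using e(1) by (intro l2_norm_diff_le) auto
  finally have E: "l2_norm (A *\<^sub>v (x - z)) \<le> 2 * \<rho>" using xfeas zfeas by linarith
  define a b where "a = 2 * \<gamma> * (1 - \<delta>) / D" and "b = 4 * \<gamma> * sqrt (1 + \<delta>) / D"
  have a: "0 < a" using D \<gamma>(1) \<delta>(2) by (simp add: a_def)
  let ?W = "{w \<in> carrier_vec (dim_vec x). card (vec_supp w) \<le> s}"
  have "vec_supp (0\<^sub>v N) = {}" by (auto simp: vec_supp_def)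
  then have "0\<^sub>v N \<in> ?W" using x by simp
  then have ne: "?W \<noteq> {}" by blast
  have "(wl1_norm \<omega> (x - z) - b * sqrt (real s) * \<rho>) / a \<le> best_approx_error s \<omega> x"
    unfolding best_approx_error_def
  proof (rule cINF_greatest[OF ne])
    fix w assume "w \<in> ?W"
    then have "wl1_norm \<omega> (x - z) \<le> a * wl1_norm \<omega> (x - w) + b * sqrt (real s) * \<rho>"
      unfolding a_def b_def D_def using x by (intro weighted_l1_error[OF x z _ _ le E]) auto
    then show "(wl1_norm \<omega> (x - z) - b * sqrt (real s) * \<rho>) / a \<le> wl1_norm \<omega> (x - w)"
      using a by (simp add: pos_divide_le_eq mult.commute)
  qed
  then have l1: "wl1_norm \<omega> (x - z) \<le> a * best_approx_error s \<omega> x + b * sqrt (real s) * \<rho>"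
    using a by (simp add: pos_divide_le_eq mult.commute)
  then show "wl1_norm \<omega> (x - z)
      \<le> 2 * \<gamma> * (1 - \<delta>) / (\<gamma> - (\<gamma> + 2) * \<delta>) * best_approx_error s \<omega> x
        + 4 * \<gamma> * sqrt (1 + \<delta>) / (\<gamma> - (\<gamma> + 2) * \<delta>) * sqrt (real s) * \<rho>"
    by (simp add: a_def b_def D_def)
  define c where "c = \<gamma> * (1 - \<delta>) * sqrt (real s)"
  have c: "0 < c" using \<gamma>(1) \<delta>(2) s by (simp add: c_def)
  have "l2_norm (x - z) \<le> wl1_norm \<omega> (x - z) / c + 2 * sqrt (1 + \<delta>) / (1 - \<delta>) * \<rho>"
    unfolding c_def using x z by (intro weighted_l2_error E) auto
  also have "wl1_norm \<omega> (x - z) / c \<le> (a * best_approx_error s \<omega> x + b * sqrt (real s) * \<rho>) / c"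
    using l1 c by (intro divide_right_mono) auto
  also have "(a * best_approx_error s \<omega> x + b * sqrt (real s) * \<rho>) / c
      = 2 / D * (best_approx_error s \<omega> x / sqrt (real s)) + 4 * sqrt (1 + \<delta>) / ((1 - \<delta>) * D) * \<rho>"
  proof -
    have ac: "a / c = 2 / D / sqrt (real s)"
      and bc: "b * sqrt (real s) / c = 4 * sqrt (1 + \<delta>) / ((1 - \<delta>) * D)"
      unfolding a_def b_def c_def using D \<gamma>(1) \<delta>(2) s
      by (simp_all add: frac_eq_eq del: right_diff_distrib_numeral)
    have "(a * best_approx_error s \<omega> x + b * sqrt (real s) * \<rho>) / c
        = a / c * best_approx_error s \<omega> x + b * sqrt (real s) / c * \<rho>"
      by (simp add: add_divide_distrib)
    then show ?thesis unfolding ac bc by simp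
  qed
  finally show "l2_norm (x - z)
      \<le> 2 / (\<gamma> - (\<gamma> + 2) * \<delta>) * (best_approx_error s \<omega> x / sqrt (real s))
        + (4 * sqrt (1 + \<delta>) / ((1 - \<delta>) * (\<gamma> - (\<gamma> + 2) * \<delta>)) + 2 * sqrt (1 + \<delta>) / (1 - \<delta>)) * \<rho>"
    by (simp add: D_def distrib_right)
qed

end

theorem theorem3p7:
  shows "\<exists>A1 B1 A2 B2 :: real \<Rightarrow> real \<Rightarrow> real.
    \<forall>(\<gamma> :: real) (m :: nat) (N :: nat) (s :: nat) (\<omega> :: real vec) (A :: complex mat).
      0 < \<gamma> \<longrightarrow> \<gamma> < 1 \<longrightarrow> 1 \<le> N \<longrightarrow> 2 \<le> s \<longrightarrow>
      \<omega> \<in> carrier_vec N \<longrightarrow> (\<forall>j<N. \<gamma> \<le> \<omega> $ j \<and> \<omega> $ j \<le> 1) \<longrightarrow>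
      A \<in> carrier_mat m N \<longrightarrow>
      rip_const A (2 * s) < \<gamma> / (\<gamma> + 2) \<longrightarrow>
      (\<forall>x e y xh :: complex vec. \<forall>\<rho> :: real.
         x \<in> carrier_vec N \<longrightarrow> e \<in> carrier_vec m \<longrightarrow> y = A *\<^sub>v x + e \<longrightarrow> l2_norm e \<le> \<rho> \<longrightarrow>
         weighted_l1_solution \<omega> A y \<rho> xh \<longrightarrow>
           wl1_norm \<omega> (x - xh)
             \<le> A1 (rip_const A (2 * s)) \<gamma> * best_approx_error s \<omega> x
               + B1 (rip_const A (2 * s)) \<gamma> * sqrt (real s) * \<rho> \<and>
           l2_norm (x - xh)
             \<le> A2 (rip_const A (2 * s)) \<gamma> * (best_approx_error s \<omega> x / sqrt (real s))
               + B2 (rip_const A (2 * s)) \<gamma> * \<rho>) \<and>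
      weighted_nsp \<omega> A s
        (rip_const A (2 * s) / (\<gamma> - (\<gamma> + 1) * rip_const A (2 * s)))"
proof (rule exI[where x = "\<lambda>\<delta> \<gamma>. 2 * \<gamma> * (1 - \<delta>) / (\<gamma> - (\<gamma> + 2) * \<delta>)"],
    rule exI[where x = "\<lambda>\<delta> \<gamma>. 4 * \<gamma> * sqrt (1 + \<delta>) / (\<gamma> - (\<gamma> + 2) * \<delta>)"],
    rule exI[where x = "\<lambda>\<delta> \<gamma>. 2 / (\<gamma> - (\<gamma> + 2) * \<delta>)"],
    rule exI[where x = "\<lambda>\<delta> \<gamma>. 4 * sqrt (1 + \<delta>) / ((1 - \<delta>) * (\<gamma> - (\<gamma> + 2) * \<delta>))
      + 2 * sqrt (1 + \<delta>) / (1 - \<delta>)"],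
    intro allI impI)
  fix \<gamma> :: real and m N s :: nat and \<omega> :: "real vec" and A :: "complex mat"
  assume \<gamma>: "0 < \<gamma>" "\<gamma> < 1" and N: "1 \<le> N" and s: "2 \<le> s"
    and \<omega>: "\<forall>j<N. \<gamma> \<le> \<omega> $ j \<and> \<omega> $ j \<le> 1" and A: "A \<in> carrier_mat m N"
    and small: "rip_const A (2 * s) < \<gamma> / (\<gamma> + 2)"
  have k: "1 \<le> 2 * s" "1 \<le> dim_col A" using s N A by auto
  have rip: "rip_bound A (2 * s) (rip_const A (2 * s))" by (rule rip_bound_rip_const[OF k])
  have "\<gamma> / (\<gamma> + 2) < 1" using \<gamma> by simp
  then have "rip_const A (2 * s) < 1" using small by (rule less_trans[rotated])
  then interpret weighted_rip_matrix A m N s "rip_const A (2 * s)" \<gamma> \<omega>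
    using A s rip rip_bound_nonneg[OF rip k] \<gamma> \<omega> small by unfold_locales auto
  show "(\<forall>x e y xh :: complex vec. \<forall>\<rho> :: real.
         x \<in> carrier_vec N \<longrightarrow> e \<in> carrier_vec m \<longrightarrow> y = A *\<^sub>v x + e \<longrightarrow> l2_norm e \<le> \<rho> \<longrightarrow>
         weighted_l1_solution \<omega> A y \<rho> xh \<longrightarrow>
           wl1_norm \<omega> (x - xh)
             \<le> 2 * \<gamma> * (1 - rip_const A (2 * s)) / (\<gamma> - (\<gamma> + 2) * rip_const A (2 * s))
                 * best_approx_error s \<omega> x
               + 4 * \<gamma> * sqrt (1 + rip_const A (2 * s)) / (\<gamma> - (\<gamma> + 2) * rip_const A (2 * s))
                 * sqrt (real s) * \<rho> \<and>
           l2_norm (x - xh)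
             \<le> 2 / (\<gamma> - (\<gamma> + 2) * rip_const A (2 * s)) * (best_approx_error s \<omega> x / sqrt (real s))
               + (4 * sqrt (1 + rip_const A (2 * s))
                   / ((1 - rip_const A (2 * s)) * (\<gamma> - (\<gamma> + 2) * rip_const A (2 * s)))
                 + 2 * sqrt (1 + rip_const A (2 * s)) / (1 - rip_const A (2 * s))) * \<rho>) \<and>
      weighted_nsp \<omega> A s
        (rip_const A (2 * s) / (\<gamma> - (\<gamma> + 1) * rip_const A (2 * s)))"
    using weighted_l1_recovery weighted_nsp_rip by blast
qed

end
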